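(* Let $(\mathcal X,d_{\mathcal X})$ be a Polish (complete separable) metric space that is not compact. Then there exists no reproducing kernel Hilbert space of functions on $\mathcal X$ that is (contained in and) dense in $(C_b(\mathcal X),\|\cdot\|_\infty)$.
   Context: $C_b(\mathcal X)$ is the space of bounded continuous real-valued functions on $\mathcal X$ with the supremum norm. A reproducing kernel Hilbert space (RKHS) on $\mathcal X$ is a Hilbert space $\mathcal H$ of real-valued functions on $\mathcal X$ for which there is a positive-definite kernel $k:\mathcal X\times\mathcal X\to\mathbb R$ with $k(x,\cdot)\in\mathcal H$ and $\langle f,k(x,\cdot)\rangle_{\mathcal H}=f(x)$ for all $x\in\mathcal X$, $f\in\mathcal H$. *)

theory Defs
  imports "HOL-Analysis.Analysis"
begin

text \<open>
  A Hilbert space of real-valued functions on the type \<open>'a\<close>: the vector space operations are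
  pointwise, and \<open>ip\<close> is constrained only on the carrier \<open>H\<close>. The last axiom
  is completeness in the induced norm. It is spelled out with sequences because the carrier-based
  \<open>Metric_space\<close> would demand a nonnegative symmetric distance also outside of \<open>H\<close>.
\<close>
locale function_hilbert_space =
  fixes H :: "('a \<Rightarrow> real) set"
    and ip :: "('a \<Rightarrow> real) \<Rightarrow> ('a \<Rightarrow> real) \<Rightarrow> real"
  assumes zero_mem: "(\<lambda>x. 0) \<in> H"
    and add_mem: "\<And>f g. f \<in> H \<Longrightarrow> g \<in> H \<Longrightarrow> (\<lambda>x. f x + g x) \<in> H"
    and scale_mem: "\<And>c f. f \<in> H \<Longrightarrow> (\<lambda>x. c * f x) \<in> H"
    and ip_commute: "\<And>f g. f \<in> H \<Longrightarrow> g \<in> H \<Longrightarrow> ip f g = ip g f"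
    and ip_add_left:
      "\<And>f g h. f \<in> H \<Longrightarrow> g \<in> H \<Longrightarrow> h \<in> H \<Longrightarrow> ip (\<lambda>x. f x + g x) h = ip f h + ip g h"
    and ip_scale_left:
      "\<And>c f g. f \<in> H \<Longrightarrow> g \<in> H \<Longrightarrow> ip (\<lambda>x. c * f x) g = c * ip f g"
    and ip_nonneg: "\<And>f. f \<in> H \<Longrightarrow> 0 \<le> ip f f"
    and ip_definite: "\<And>f. f \<in> H \<Longrightarrow> ip f f = 0 \<Longrightarrow> f = (\<lambda>x. 0)"
    and complete:
      "\<And>\<sigma> :: nat \<Rightarrow> 'a \<Rightarrow> real.
         \<forall>n. \<sigma> n \<in> H \<Longrightarrow>
         \<forall>e>0. \<exists>N. \<forall>m\<ge>N. \<forall>n\<ge>N.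
           sqrt (ip (\<lambda>x. \<sigma> m x - \<sigma> n x) (\<lambda>x. \<sigma> m x - \<sigma> n x)) < e \<Longrightarrow>
         \<exists>f\<in>H. (\<lambda>n. sqrt (ip (\<lambda>x. \<sigma> n x - f x) (\<lambda>x. \<sigma> n x - f x))) \<longlonglongrightarrow> 0"

text \<open>
  Positive definite in the sense customary for reproducing kernels: symmetric, with every Gram
  matrix positive semidefinite (the quadratic form may vanish for nonzero coefficients).
\<close>
definition positive_definite_kernel :: "('a \<Rightarrow> 'a \<Rightarrow> real) \<Rightarrow> bool" where
  "positive_definite_kernel k \<longleftrightarrow>
     (\<forall>x y. k x y = k y x) \<and>
     (\<forall>(n::nat) (x :: nat \<Rightarrow> 'a) (c :: nat \<Rightarrow> real).
        0 \<le> (\<Sum>i<n. \<Sum>j<n. c i * c j * k (x i) (x j)))"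

definition rkhs :: "('a \<Rightarrow> real) set \<Rightarrow> (('a \<Rightarrow> real) \<Rightarrow> ('a \<Rightarrow> real) \<Rightarrow> real) \<Rightarrow> bool" where
  "rkhs H ip \<longleftrightarrow>
     function_hilbert_space H ip \<and>
     (\<exists>k. positive_definite_kernel k \<and>
          (\<forall>x. k x \<in> H) \<and> (\<forall>f\<in>H. \<forall>x. ip f (k x) = f x))"

end

theory Submission
  imports Defs
begin

text \<open>
  A metric space that is not compact contains a sequence of distinct points without limit points,
  and on it the Tietze extension theorem realises every sequence of signs by a bounded continuous
  function (\<open>bcontfun_prescribed_values\<close>). So if a space \<open>H\<close> of functions is dense in the bounded
  continuous functions, then for every choice of signs some \<open>f \<in> H\<close> stays within \<open>1/2\<close> of them along
  the whole sequence. A reproducing kernel Hilbert space of bounded functions cannot do this.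

  The reason is that its kernel sections \<open>k x\<close> have bounded norm, by the uniform
  boundedness principle (\<open>kernel_bounded_if_functions_bounded\<close>; this is where the completeness of
  \<open>H\<close> enters). Hence one can choose the signs \<open>s i\<close> greedily so that the norm of
  \<open>\<Sum>i<n. s i * k (x i)\<close> is at most a constant times \<open>sqrt n\<close> (\<open>signed_kernel_sum_small\<close>). The inner
  product of this sum with \<open>f\<close> is \<open>\<Sum>i<n. s i * f (x i)\<close>, which is at least \<open>n/2\<close> if \<open>f\<close> stays within
  \<open>1/2\<close> of the signs. For large \<open>n\<close> this contradicts the Cauchy-Schwarz inequality
  (\<open>unreachable_sign_pattern\<close>).
\<close>

section \<open>Geometry of a Hilbert space of functions\<close>

context function_hilbert_space
begin

definition fnorm :: "('a \<Rightarrow> real) \<Rightarrow> real" where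
  "fnorm f = sqrt (ip f f)"

lemma diff_mem: "f \<in> H \<Longrightarrow> g \<in> H \<Longrightarrow> (\<lambda>x. f x - g x) \<in> H"
  using add_mem[of f "\<lambda>x. (-1) * g x"] scale_mem[of g "-1"] by simp

lemma fnorm_nonneg: "f \<in> H \<Longrightarrow> 0 \<le> fnorm f"
  by (simp add: fnorm_def ip_nonneg)

lemma fnorm_square: "f \<in> H \<Longrightarrow> (fnorm f)\<^sup>2 = ip f f"
  by (simp add: fnorm_def ip_nonneg)

lemma ip_square_lincomb:
  assumes f: "f \<in> H" and g: "g \<in> H"
  shows "ip (\<lambda>x. a * f x + b * g x) (\<lambda>x. a * f x + b * g x)
         = a\<^sup>2 * ip f f + 2 * a * b * ip f g + b\<^sup>2 * ip g g"
proof -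
  let ?h = "\<lambda>x. a * f x + b * g x"
  have af: "(\<lambda>x. a * f x) \<in> H" and bg: "(\<lambda>x. b * g x) \<in> H"
    using f g scale_mem by auto
  have h: "?h \<in> H" using add_mem[OF af bg] .
  have left: "ip ?h u = a * ip f u + b * ip g u" if "u \<in> H" for u
    using ip_add_left[OF af bg that] ip_scale_left[OF f that] ip_scale_left[OF g that] by simp
  have "ip ?h ?h = a * ip ?h f + b * ip ?h g"
    using left[OF h] ip_commute[OF f h] ip_commute[OF g h] by simp
  then show ?thesis
    using left[OF f] left[OF g] ip_commute[OF f g] by (simp add: algebra_simps power2_eq_square)
qed

lemma Cauchy_Schwarz:
  assumes f: "f \<in> H" and g: "g \<in> H"
  shows "\<bar>ip f g\<bar> \<le> fnorm f * fnorm g"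
proof (cases "ip g g = 0")
  case True
  then have "g = (\<lambda>x. 0)" using ip_definite g by blast
  then have "ip f g = 0"
    using ip_commute[OF f g] ip_scale_left[OF g f, of 0] by simp
  then show ?thesis by (simp add: fnorm_nonneg f g)
next
  case False
  then have pos: "ip g g > 0" using ip_nonneg[OF g] by simp
  \<comment> \<open>up to the factor \<open>ip g g\<close>, the component of \<open>f\<close> orthogonal to \<open>g\<close>\<close>
  let ?h = "\<lambda>x. ip g g * f x + (- ip f g) * g x"
  have "?h \<in> H" using add_mem scale_mem f g by blast
  then have "0 \<le> ip ?h ?h" by (rule ip_nonneg)
  also have "\<dots> = ip g g * (ip f f * ip g g - (ip f g)\<^sup>2)"
    unfolding ip_square_lincomb[OF f g] by (simp add: algebra_simps power2_eq_square)
  finally have "(ip f g)\<^sup>2 \<le> ip f f * ip g g"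
    using pos by (simp add: zero_le_mult_iff)
  then have "sqrt ((ip f g)\<^sup>2) \<le> sqrt (ip f f * ip g g)"
    by (rule real_sqrt_le_mono)
  then show ?thesis by (simp add: fnorm_def real_sqrt_mult)
qed

lemma fnorm_scale: "f \<in> H \<Longrightarrow> fnorm (\<lambda>x. c * f x) = \<bar>c\<bar> * fnorm f"
  using ip_square_lincomb[of f f c 0] by (simp add: fnorm_def real_sqrt_mult)

lemma fnorm_triangle:
  assumes f: "f \<in> H" and g: "g \<in> H"
  shows "fnorm (\<lambda>x. f x + g x) \<le> fnorm f + fnorm g"
proof (rule power2_le_imp_le)
  have "(fnorm (\<lambda>x. f x + g x))\<^sup>2 = (fnorm f)\<^sup>2 + 2 * ip f g + (fnorm g)\<^sup>2"
    using ip_square_lincomb[OF f g, of 1 1] by (simp add: fnorm_square add_mem f g)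
  also have "\<dots> \<le> (fnorm f + fnorm g)\<^sup>2"
    using Cauchy_Schwarz[OF f g] by (simp add: power2_sum)
  finally show "(fnorm (\<lambda>x. f x + g x))\<^sup>2 \<le> (fnorm f + fnorm g)\<^sup>2" .
qed (simp add: fnorm_nonneg f g)

lemma fnorm_diff_triangle:
  assumes f: "f \<in> H" and g: "g \<in> H" and h: "h \<in> H"
  shows "fnorm (\<lambda>x. f x - g x) \<le> fnorm (\<lambda>x. f x - h x) + fnorm (\<lambda>x. g x - h x)"
proof -
  have "fnorm (\<lambda>x. f x - g x) = fnorm (\<lambda>x. (f x - h x) + (-1) * (g x - h x))"
    by simp
  also have "\<dots> \<le> fnorm (\<lambda>x. f x - h x) + fnorm (\<lambda>x. (-1) * (g x - h x))"
    by (rule fnorm_triangle[OF diff_mem[OF f h] scale_mem[OF diff_mem[OF g h]]])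
  also have "fnorm (\<lambda>x. (-1) * (g x - h x)) = fnorm (\<lambda>x. g x - h x)"
    unfolding fnorm_scale[OF diff_mem[OF g h]] by simp
  finally show ?thesis .
qed

end

section \<open>Boundedness of the kernel\<close>

locale reproducing_kernel = function_hilbert_space H ip
  for H :: "('a \<Rightarrow> real) set" and ip +
  fixes k :: "'a \<Rightarrow> 'a \<Rightarrow> real"
  assumes kernel_mem: "k x \<in> H"
    and reproducing: "f \<in> H \<Longrightarrow> ip f (k x) = f x"
begin

lemma fnorm_kernel_square: "(fnorm (k x))\<^sup>2 = k x x"
  by (simp add: fnorm_square kernel_mem reproducing)

lemma eval_le_fnorm: "f \<in> H \<Longrightarrow> \<bar>f x\<bar> \<le> fnorm f * fnorm (k x)"
  using Cauchy_Schwarz[OF _ kernel_mem] reproducing by metis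

text \<open>
  This is the uniform boundedness principle for the evaluation functionals.
  If the norms of the \<open>k x\<close> were unbounded, pick \<open>x n\<close> with \<open>fnorm (k (x n)) \<ge> 4 ^ n\<close> and add up
  steps of length \<open>(1/3) ^ n\<close> in the directions \<open>\<plusminus> k (x n)\<close>, each sign chosen so that the new step does
  not cancel the value already attained at \<open>x n\<close>. All later steps together are at most half
  as long as step \<open>n\<close>, so the sum has absolute value at least \<open>(4/3) ^ n / 2\<close> at \<open>x n\<close>.
\<close>
lemma kernel_bounded_if_functions_bounded:
  assumes bdd: "\<And>f. f \<in> H \<Longrightarrow> bounded (range f)"
  shows "\<exists>R\<ge>0. \<forall>x. fnorm (k x) \<le> R"
proof (rule ccontr)
  assume "\<not> ?thesis"
  then have "\<exists>x. 4 ^ n < fnorm (k x)" for n :: nat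
    by (meson not_le zero_le_numeral zero_le_power)
  then obtain x where x: "\<And>n::nat. 4 ^ n < fnorm (k (x n))" by metis
  have kpos: "0 < fnorm (k (x n))" for n
    using x[of n] by (rule le_less_trans[rotated]) simp
  define a :: "('a \<Rightarrow> real) \<Rightarrow> nat \<Rightarrow> real" where
    "a = (\<lambda>f n. (if 0 \<le> f (x n) then 1 else -1) * (1/3) ^ n / fnorm (k (x n)))"
  define F where "F = rec_nat (\<lambda>y. 0) (\<lambda>n f y. f y + a f n * k (x n) y)"
  have F0: "F 0 = (\<lambda>y. 0)" and FS: "F (Suc n) = (\<lambda>y. F n y + a (F n) n * k (x n) y)" for n
    by (simp_all add: F_def)
  have FH: "F n \<in> H" for n
    by (induction n) (simp_all add: F0 FS zero_mem add_mem scale_mem kernel_mem)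
  have stepnorm: "fnorm (\<lambda>y. a (F n) n * k (x n) y) = (1/3) ^ n" for n
    unfolding fnorm_scale[OF kernel_mem] using kpos[of n] by (simp add: a_def abs_mult)
  \<comment> \<open>the right-hand side is the geometric sum of the step lengths \<open>n, ..., n + p - 1\<close>\<close>
  have tail: "fnorm (\<lambda>y. F (n + p) y - F n y) \<le> 3/2 * ((1/3) ^ n - (1/3) ^ (n + p))" for n p
  proof (induction p)
    case 0
    have "fnorm (\<lambda>y. 0) = 0" using fnorm_scale[OF zero_mem, of 0] by simp
    then show ?case by simp
  next
    case (Suc p)
    have "fnorm (\<lambda>y. F (n + Suc p) y - F n y)
        = fnorm (\<lambda>y. (F (n + p) y - F n y) + a (F (n + p)) (n + p) * k (x (n + p)) y)"
      by (simp add: FS algebra_simps)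
    also have "\<dots> \<le> fnorm (\<lambda>y. F (n + p) y - F n y) + (1/3) ^ (n + p)"
      using fnorm_triangle[OF diff_mem[OF FH FH] scale_mem[OF kernel_mem],
          of "n + p" n "a (F (n + p)) (n + p)" "x (n + p)"]
      unfolding stepnorm .
    also have "\<dots> \<le> 3/2 * ((1/3) ^ n - (1/3) ^ (n + Suc p))"
    proof -
      have "(1/3::real) ^ (n + Suc p) = 1/3 * (1/3) ^ (n + p)" by simp
      then show ?thesis using Suc.IH by (simp only:) argo
    qed
    finally show ?case .
  qed
  have tail_le: "fnorm (\<lambda>y. F m y - F n y) \<le> 3/2 * (1/3) ^ n" if "n \<le> m" for m n
  proof -
    have "fnorm (\<lambda>y. F m y - F n y) \<le> 3/2 * ((1/3) ^ n - (1/3) ^ m)"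
      using tail[of n "m - n"] that by simp
    also have "\<dots> \<le> 3/2 * (1/3) ^ n" by simp
    finally show ?thesis .
  qed
  have Cauchy: "\<exists>N. \<forall>m\<ge>N. \<forall>n\<ge>N. fnorm (\<lambda>y. F m y - F n y) < e" if "e > 0" for e
  proof -
    have "(\<lambda>N. 3 * (1/3::real) ^ N) \<longlonglongrightarrow> 3 * 0"
      by (intro tendsto_intros LIMSEQ_power_zero) simp
    then have "eventually (\<lambda>N. 3 * (1/3::real) ^ N < e) sequentially"
      using that by (simp add: order_tendsto_iff)
    then obtain N where N: "3 * (1/3::real) ^ N < e"
      by (auto simp: eventually_sequentially)
    have "fnorm (\<lambda>y. F m y - F n y) < e" if "m \<ge> N" "n \<ge> N" for m n
    proof -
      have "fnorm (\<lambda>y. F m y - F n y) \<le> fnorm (\<lambda>y. F m y - F N y) + fnorm (\<lambda>y. F n y - F N y)"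
        by (rule fnorm_diff_triangle[OF FH FH FH])
      also have "\<dots> \<le> 3 * (1/3) ^ N"
        using tail_le[OF that(1)] tail_le[OF that(2)] by simp
      finally show ?thesis using N by simp
    qed
    then show ?thesis by blast
  qed
  obtain f where f: "f \<in> H" and lim: "(\<lambda>n. fnorm (\<lambda>y. F n y - f y)) \<longlonglongrightarrow> 0"
    using complete[of F] FH Cauchy unfolding fnorm_def by blast
  have pointwise: "(\<lambda>n. F n y) \<longlonglongrightarrow> f y" for y
  proof -
    have "(\<lambda>n. fnorm (\<lambda>z. F n z - f z) * fnorm (k y)) \<longlonglongrightarrow> 0"
      using tendsto_mult_left_zero[OF lim] .
    then have "(\<lambda>n. F n y - f y) \<longlonglongrightarrow> 0"
      by (rule Lim_null_comparison[rotated])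
        (use eval_le_fnorm[OF diff_mem[OF FH f]] in auto)
    then show ?thesis by (simp add: LIM_zero_iff)
  qed
  have large: "(4/3) ^ n / 2 \<le> \<bar>f (x n)\<bar>" for n
  proof -
    have "\<bar>F m (x n) - F (Suc n) (x n)\<bar> \<le> 1/2 * (1/3) ^ n * fnorm (k (x n))" if "m \<ge> Suc n" for m
    proof -
      have "\<bar>F m (x n) - F (Suc n) (x n)\<bar> \<le> fnorm (\<lambda>y. F m y - F (Suc n) y) * fnorm (k (x n))"
        by (rule eval_le_fnorm[OF diff_mem[OF FH FH]])
      also have "\<dots> \<le> 3/2 * (1/3) ^ Suc n * fnorm (k (x n))"
        using kpos[of n] by (intro mult_right_mono tail_le that) auto
      finally show ?thesis by simp
    qed
    moreover have "(\<lambda>m. \<bar>F m (x n) - F (Suc n) (x n)\<bar>) \<longlonglongrightarrow> \<bar>f (x n) - F (Suc n) (x n)\<bar>"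
      by (intro tendsto_intros pointwise)
    ultimately have near: "\<bar>f (x n) - F (Suc n) (x n)\<bar> \<le> 1/2 * (1/3) ^ n * fnorm (k (x n))"
      by (intro LIMSEQ_le_const2) blast+
    have "a (F n) n * k (x n) (x n)
        = (if 0 \<le> F n (x n) then 1 else -1) * ((1/3) ^ n * fnorm (k (x n)))"
      using kpos[of n] by (simp add: a_def flip: fnorm_kernel_square) (simp add: power2_eq_square)
    moreover have "0 \<le> (1/3) ^ n * fnorm (k (x n))"
      using kpos[of n] by simp
    ultimately have "(1/3) ^ n * fnorm (k (x n)) \<le> \<bar>F (Suc n) (x n)\<bar>"
      by (auto simp: FS split: if_splits)
    then have "1/2 * ((1/3) ^ n * fnorm (k (x n))) \<le> \<bar>f (x n)\<bar>"
      using near by linarith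
    moreover have "(1/3) ^ n * 4 ^ n \<le> (1/3) ^ n * fnorm (k (x n))"
      using x[of n] by (intro mult_left_mono) auto
    ultimately show ?thesis by (simp flip: power_mult_distrib)
  qed
  obtain B where B: "\<And>y. \<bar>f y\<bar> \<le> B"
    using bdd[OF f] by (auto simp: bounded_iff)
  obtain n where "2 * B < (4/3) ^ n"
    using real_arch_pow[of "4/3" "2 * B"] by auto
  then show False using large[of n] B[of "x n"] by simp
qed

section \<open>Sign patterns that are out of reach\<close>

text \<open>
  Choosing each sign so that the new term has nonpositive inner product with the partial sum
  makes the square of the norm grow only linearly.
\<close>
lemma signed_kernel_sum_small:
  fixes x :: "nat \<Rightarrow> 'a"
  assumes R: "\<And>y. fnorm (k y) \<le> R"
  obtains s :: "nat \<Rightarrow> real" where "\<And>n. \<bar>s n\<bar> = 1"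
    and "\<And>n. (\<lambda>y. \<Sum>i<n. s i * k (x i) y) \<in> H"
    and "\<And>n. (fnorm (\<lambda>y. \<Sum>i<n. s i * k (x i) y))\<^sup>2 \<le> real n * R\<^sup>2"
proof -
  define \<sigma> :: "('a \<Rightarrow> real) \<Rightarrow> nat \<Rightarrow> real" where
    "\<sigma> = (\<lambda>g n. if 0 \<le> g (x n) then -1 else 1)"
  define S where "S = rec_nat (\<lambda>y. 0) (\<lambda>n g y. g y + \<sigma> g n * k (x n) y)"
  define s where "s n = \<sigma> (S n) n" for n
  have S0: "S 0 = (\<lambda>y. 0)" and SS: "S (Suc n) = (\<lambda>y. S n y + s n * k (x n) y)" for n
    by (simp_all add: S_def s_def)
  have S_sum: "S n = (\<lambda>y. \<Sum>i<n. s i * k (x i) y)" for n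
    by (induction n) (simp_all add: S0 SS)
  have SH: "S n \<in> H" for n
    by (induction n) (simp_all add: S0 SS zero_mem add_mem scale_mem kernel_mem)
  have s: "\<bar>s n\<bar> = 1" "s n * S n (x n) \<le> 0" for n
    by (auto simp: s_def \<sigma>_def)
  have "(fnorm (S n))\<^sup>2 \<le> real n * R\<^sup>2" for n
  proof (induction n)
    case 0
    show ?case using fnorm_scale[OF zero_mem, of 0] by (simp add: S0)
  next
    case (Suc n)
    have "(fnorm (S (Suc n)))\<^sup>2
        = (fnorm (S n))\<^sup>2 + 2 * (s n * S n (x n)) + (s n)\<^sup>2 * (fnorm (k (x n)))\<^sup>2"
      using ip_square_lincomb[OF SH kernel_mem, of 1 n "s n" "x n"] SH[of "Suc n"]
      by (simp add: fnorm_square SH kernel_mem reproducing SS)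
    moreover have "(s n)\<^sup>2 = 1" using s(1)[of n] by (simp add: abs_square_eq_1)
    moreover have "(fnorm (k (x n)))\<^sup>2 \<le> R\<^sup>2"
      by (intro power_mono R fnorm_nonneg kernel_mem)
    ultimately show ?case using Suc s(2)[of n] by (simp add: algebra_simps)
  qed
  then show ?thesis using that[of s] s(1) SH unfolding S_sum by blast
qed

text \<open>
  Pair \<open>f\<close> with \<open>S n = (\<Sum>i<n. s i * k (x i))\<close>. The reproducing property gives at least
  \<open>n/2\<close>, because \<open>s i * f (x i) \<ge> 1/2\<close>, while the Cauchy-Schwarz inequality gives
  at most \<open>fnorm f * R * sqrt n\<close>.
\<close>
lemma unreachable_sign_pattern:
  fixes x :: "nat \<Rightarrow> 'a"
  assumes R: "\<And>y. fnorm (k y) \<le> R"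
  obtains s :: "nat \<Rightarrow> real" where "\<And>n. \<bar>s n\<bar> = 1"
    and "\<And>f. f \<in> H \<Longrightarrow> \<exists>n. \<bar>f (x n) - s n\<bar> > 1/2"
proof -
  obtain s :: "nat \<Rightarrow> real" where s: "\<And>n. \<bar>s n\<bar> = 1"
    and SH: "\<And>n. (\<lambda>y. \<Sum>i<n. s i * k (x i) y) \<in> H"
    and small: "\<And>n. (fnorm (\<lambda>y. \<Sum>i<n. s i * k (x i) y))\<^sup>2 \<le> real n * R\<^sup>2"
    by (rule signed_kernel_sum_small[OF R, of x]) (rule that)
  have False if f: "f \<in> H" and near: "\<And>n. \<bar>f (x n) - s n\<bar> \<le> 1/2" for f
  proof -
    have pairing: "ip (\<lambda>y. \<Sum>i<n. s i * k (x i) y) f = (\<Sum>i<n. s i * f (x i))" for n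
    proof (induction n)
      case 0
      show ?case using ip_scale_left[OF f f, of 0] by simp
    next
      case (Suc n)
      then show ?case
        using ip_add_left[OF SH[of n] scale_mem[OF kernel_mem] f, of "s n" "x n"]
          ip_scale_left[OF kernel_mem f] ip_commute[OF kernel_mem f] reproducing[OF f] by simp
    qed
    have bound: "real n \<le> 4 * ((fnorm f)\<^sup>2 * R\<^sup>2)" if "n > 0" for n
    proof -
      let ?S = "\<lambda>y. \<Sum>i<n. s i * k (x i) y"
      have "1/2 \<le> s i * f (x i)" for i
        using s[of i] near[of i] by (auto simp: abs_if split: if_splits)
      then have "real n / 2 \<le> (\<Sum>i<n. s i * f (x i))"
        using sum_bounded_below[of "{..<n}" "1/2" "\<lambda>i. s i * f (x i)"] by simp
      also have "\<dots> \<le> fnorm ?S * fnorm f"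
        using Cauchy_Schwarz[OF SH f, of n] pairing[of n] by simp
      finally have "(real n / 2)\<^sup>2 \<le> (fnorm ?S * fnorm f)\<^sup>2"
        by (intro power_mono) auto
      also have "\<dots> \<le> (real n * R\<^sup>2) * (fnorm f)\<^sup>2"
        unfolding power_mult_distrib by (intro mult_right_mono small) simp
      finally have "real n * real n \<le> real n * (4 * ((fnorm f)\<^sup>2 * R\<^sup>2))"
        by (simp add: power2_eq_square field_simps)
      then show ?thesis using that by (simp add: mult_le_cancel_left)
    qed
    obtain n :: nat where "4 * ((fnorm f)\<^sup>2 * R\<^sup>2) < real n"
      using reals_Archimedean2 by blast
    then show False using bound[of "Suc n"] by simp
  qed
  then show ?thesis using that[of s] s by (meson not_le)
qed

end

section \<open>Prescribing values on a closed discrete sequence\<close>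

lemma noncompact_closed_discrete_sequence:
  assumes "\<not> compact (UNIV :: 'a::metric_space set)"
  obtains x :: "nat \<Rightarrow> 'a::metric_space" where "inj x" "\<And>y. \<not> y islimpt range x"
proof -
  obtain T :: "'a set" where T: "infinite T" "\<And>y. \<not> y islimpt T"
    using assms unfolding compact_eq_Bolzano_Weierstrass by auto
  obtain x :: "nat \<Rightarrow> 'a" where x: "inj x" "range x \<subseteq> T"
    using infinite_countable_subset[OF T(1)] by blast
  then show ?thesis using that[of x] T(2) islimpt_subset by blast
qed

text \<open>
  Every subset of \<open>range x\<close> is closed because it has no limit points, so any function on \<open>range x\<close>
  is continuous and the Tietze extension theorem applies to it.
\<close>
lemma bcontfun_prescribed_values:
  fixes x :: "nat \<Rightarrow> 'a::{metric_space,second_countable_topology}" and s :: "nat \<Rightarrow> real"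
  assumes inj: "inj x" and discrete: "\<And>y. \<not> y islimpt range x" and s: "\<And>n. \<bar>s n\<bar> \<le> 1"
  obtains g :: "'a \<Rightarrow>\<^sub>C real"
    where "\<And>n. apply_bcontfun g (x n) = s n"
proof -
  define h where "h y = s (inv x y)" for y
  have hx: "h (x n) = s n" for n by (simp add: h_def inj)
  have closed: "closed T" if "T \<subseteq> range x" for T
    using discrete islimpt_subset[OF _ that] by (auto simp: closed_limpt)
  have "continuous_on (range x) h"
    unfolding continuous_on_closed_invariant
  proof (intro allI impI)
    fix B :: "real set"
    show "\<exists>A. closed A \<and> A \<inter> range x = h -` B \<inter> range x"
      by (rule exI[of _ "h -` B \<inter> range x"]) (auto intro: closed)
  qed
  moreover have "closedin (top_of_set UNIV) (range x)"
    using closed by simp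
  moreover have "norm (h y) \<le> 1" if "y \<in> range x" for y
    using that s by (auto simp: hx)
  ultimately obtain g where g: "continuous_on UNIV g" "\<And>y. y \<in> range x \<Longrightarrow> g y = h y"
      "\<And>y. norm (g y) \<le> 1"
    using Tietze[of "range x" h UNIV 1] by (metis UNIV_I zero_le_one)
  then have "g \<in> bcontfun"
    unfolding bcontfun_def by (auto simp: bounded_iff)
  then show ?thesis
    using that[of "Bcontfun g"] g(2) hx by (auto simp: Bcontfun_inverse)
qed

theorem proposition2p6:
  assumes "\<not> compact (UNIV :: 'a::polish_space set)"
  shows "\<not> (\<exists>(H :: ('a \<Rightarrow> real) set) ip.
            rkhs H ip \<and> H \<subseteq> bcontfun \<and>
            closure {f :: 'a \<Rightarrow>\<^sub>C real. apply_bcontfun f \<in> H} = UNIV)"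
proof (rule notI, elim exE conjE)
  fix H :: "('a \<Rightarrow> real) set" and ip
  assume rkhs: "rkhs H ip" and sub: "H \<subseteq> bcontfun"
    and dense: "closure {f :: 'a \<Rightarrow>\<^sub>C real. apply_bcontfun f \<in> H} = UNIV"
  obtain k where "function_hilbert_space H ip" "\<forall>x. k x \<in> H" "\<forall>f\<in>H. \<forall>x. ip f (k x) = f x"
    using rkhs unfolding rkhs_def by blast
  then interpret reproducing_kernel H ip k
    by (simp add: reproducing_kernel_def reproducing_kernel_axioms_def)
  have "bounded (range f)" if "f \<in> H" for f
    using sub that by (auto simp: bcontfun_def)
  then obtain R where R: "\<And>y. fnorm (k y) \<le> R"
    using kernel_bounded_if_functions_bounded by blast
  obtain x :: "nat \<Rightarrow> 'a" where x: "inj x" "\<And>y. \<not> y islimpt range x"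
    using noncompact_closed_discrete_sequence[OF assms] by blast
  obtain s :: "nat \<Rightarrow> real" where s: "\<And>n. \<bar>s n\<bar> = 1"
    and far: "\<And>f. f \<in> H \<Longrightarrow> \<exists>n. \<bar>f (x n) - s n\<bar> > 1/2"
    using unreachable_sign_pattern[OF R, of x] by metis
  obtain g :: "'a \<Rightarrow>\<^sub>C real" where g: "\<And>n. apply_bcontfun g (x n) = s n"
    using bcontfun_prescribed_values[OF x, of s] s by (metis order_refl)
  have "g \<in> closure {f :: 'a \<Rightarrow>\<^sub>C real. apply_bcontfun f \<in> H}" by (simp add: dense)
  then obtain f :: "'a \<Rightarrow>\<^sub>C real" where f: "apply_bcontfun f \<in> H" "dist f g < 1/2"
    unfolding closure_approachable by (metis half_gt_zero_iff mem_Collect_eq zero_less_one)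
  have "\<bar>apply_bcontfun f (x n) - s n\<bar> \<le> 1/2" for n
    using dist_bounded[of f "x n" g] f(2) g[of n] by (simp add: dist_real_def)
  then show False using far[OF f(1)] by (meson not_le)
qed

end
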